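(* Let $A\in\mathbb{R}^{n\times N}$, $\mathbf{b}\in\mathbb{R}^n$, $\mathcal{A}=\{\mathbf{x}\in\mathbb{R}^N: A\mathbf{x}=\mathbf{b}\}$, and $\mathcal{L}_s(\mathbb{R}^N)=\{\mathbf{x}\in\mathbb{R}^N:\|\mathbf{x}\|_0=s\}$. If $\mathbf{x}_\star$ is an isolated point of $\mathcal{L}_s(\mathbb{R}^N)\cap\mathcal{A}$, then the alternating projection algorithm $$\mathbf{y}_k=\mathcal{P}_{\mathcal{L}_s}(\mathbf{x}_k),\qquad \mathbf{x}_{k+1}=\mathcal{P}_{\mathcal{A}}(\mathbf{y}_k),\qquad \mathbf{x}_0\in\mathcal{A},$$ converges locally to $\mathbf{x}_\star$ linearly.
   Context: $\|\mathbf{x}\|_0$ is the number of nonzero components of $\mathbf{x}$. $\mathcal{P}_{\mathcal{A}}$ is the orthogonal projection onto the affine space $\mathcal{A}$. $\mathcal{P}_{\mathcal{L}_s}$ is the nearest-point projection onto $\mathcal{L}_s(\mathbb{R}^N)$, computed by keeping the $s$ components of largest magnitude and setting the $N-s$ smallest (in magnitude) components to zero. "Converges locally to $\mathbf{x}_\star$ linearly" means: there exist a neighborhood $V$ of $\mathbf{x}_\star$ and a constant $c\in(0,1)$ such that if $\mathbf{x}_0\in V$ (with $\mathbf{x}_0\in\mathcal{A}$), then $\|\mathbf{x}_k-\mathbf{x}_\star\|\le c^k\|\mathbf{x}_0-\mathbf{x}_\star\|$ for all $k\ge 0$, with $\|\cdot\|$ the Euclidean norm. *)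

theory Defs
  imports "HOL-Analysis.Analysis"
begin

definition norm0 :: "real ^ 'N \<Rightarrow> nat" where
  "norm0 x = card {i. x $ i \<noteq> 0}"

definition sparse_vectors :: "nat \<Rightarrow> (real ^ 'N) set" where
  "sparse_vectors s = {x. norm0 x = s}"

definition affine_solutions :: "real ^ 'N ^ 'n \<Rightarrow> real ^ 'n \<Rightarrow> (real ^ 'N) set" where
  "affine_solutions A b = {x. A *v x = b}"

definition nearest_points :: "'a::metric_space set \<Rightarrow> 'a \<Rightarrow> 'a set" where
  "nearest_points S x = {y \<in> S. \<forall>z\<in>S. dist x y \<le> dist x z}"

(* The set of vectors with exactly s nonzero components is neither convex nor closed, so a nearest
   point need be neither unique (ties between magnitudes) nor existent (fewer than s nonzero
   components).  A projection is therefore any map that selects a nearest point whenever there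
   is one; elsewhere its value is arbitrary.  Keeping s components of largest magnitude is such
   a map, see hard_thresholding_is_nearest_point_map. *)
definition nearest_point_map :: "'a::metric_space set \<Rightarrow> ('a \<Rightarrow> 'a) \<Rightarrow> bool" where
  "nearest_point_map S P \<longleftrightarrow> (\<forall>x. nearest_points S x \<noteq> {} \<longrightarrow> P x \<in> nearest_points S x)"

definition alternating_projections ::
    "('a \<Rightarrow> 'a) \<Rightarrow> ('a \<Rightarrow> 'a) \<Rightarrow> (nat \<Rightarrow> 'a) \<Rightarrow> (nat \<Rightarrow> 'a) \<Rightarrow> bool" where
  "alternating_projections P Q x y \<longleftrightarrow> (\<forall>k. y k = P (x k) \<and> x (Suc k) = Q (y k))"

lemma nearest_point_map_closest_point: "nearest_point_map S (closest_point S)"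
  unfolding nearest_point_map_def
proof (intro allI impI)
  fix x assume "nearest_points S x \<noteq> {}"
  then have "\<exists>y. y \<in> S \<and> (\<forall>z\<in>S. dist x y \<le> dist x z)"
    by (auto simp: nearest_points_def)
  from someI_ex[OF this] show "closest_point S x \<in> nearest_points S x"
    by (simp add: nearest_points_def closest_point_def)
qed

definition hard_thresholding :: "nat \<Rightarrow> real ^ 'N \<Rightarrow> real ^ 'N \<Rightarrow> bool" where
  "hard_thresholding s x y \<longleftrightarrow>
     (\<exists>I. card I = s \<and> (\<forall>i\<in>I. \<forall>j\<in>-I. \<bar>x $ j\<bar> \<le> \<bar>x $ i\<bar>) \<and>
          y = (\<chi> i. if i \<in> I then x $ i else 0))"

lemma hard_thresholding_nearest:
  fixes x y :: "real ^ 'N"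
  assumes "hard_thresholding s x y" "y \<in> sparse_vectors s"
  shows "y \<in> nearest_points (sparse_vectors s) x"
proof -
  obtain I where I: "card I = s" "\<And>i j. i \<in> I \<Longrightarrow> j \<notin> I \<Longrightarrow> \<bar>x $ j\<bar> \<le> \<bar>x $ i\<bar>"
    and y: "y = (\<chi> i. if i \<in> I then x $ i else 0)"
    using assms(1) unfolding hard_thresholding_def by auto
  have "dist x y \<le> dist x z" if z: "z \<in> sparse_vectors s" for z
  proof -
    define T where "T = {i. z $ i \<noteq> 0}"
    have cT: "card T = s"
      using z by (simp add: sparse_vectors_def norm0_def T_def)
    have cards: "card (T - I) = card (I - T)"
      using I(1) cT card_Int_Diff[of T I] card_Int_Diff[of I T] by (simp add: Int_commute)
    then obtain f where f: "bij_betw f (T - I) (I - T)"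
      using finite_same_card_bij[OF _ _ cards] by auto
    have "(\<Sum>i\<in>T - I. (x $ i)\<^sup>2) \<le> (\<Sum>i\<in>T - I. (x $ f i)\<^sup>2)"
    proof (rule sum_mono)
      fix i assume i: "i \<in> T - I"
      then have "f i \<in> I" using f by (auto simp: bij_betw_def)
      then have "\<bar>x $ i\<bar> \<le> \<bar>x $ f i\<bar>" using I(2) i by auto
      then show "(x $ i)\<^sup>2 \<le> (x $ f i)\<^sup>2" by (simp add: abs_le_square_iff)
    qed
    also have "\<dots> = (\<Sum>i\<in>I - T. (x $ i)\<^sup>2)"
      using sum.reindex_bij_betw[OF f] .
    finally have exch: "(\<Sum>i\<in>T - I. (x $ i)\<^sup>2) \<le> (\<Sum>i\<in>I - T. (x $ i)\<^sup>2)" .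
    have "(norm (x - y))\<^sup>2 = (\<Sum>i\<in>UNIV. ((x - y) $ i)\<^sup>2)"
      by (simp add: norm_vec_def L2_set_def sum_nonneg)
    also have "\<dots> = (\<Sum>i\<in>UNIV. if i \<in> -I then (x $ i)\<^sup>2 else 0)"
      by (rule sum.cong) (auto simp: y)
    also have "\<dots> = (\<Sum>i\<in>-I. (x $ i)\<^sup>2)"
      by (simp add: sum.If_cases Compl_eq)
    also have "\<dots> = (\<Sum>i\<in>(T - I) \<union> (-I - T). (x $ i)\<^sup>2)"
      by (rule sum.cong) auto
    also have "\<dots> = (\<Sum>i\<in>T - I. (x $ i)\<^sup>2) + (\<Sum>i\<in>-I - T. (x $ i)\<^sup>2)"
      by (rule sum.union_disjoint) auto
    also have "\<dots> \<le> (\<Sum>i\<in>I - T. (x $ i)\<^sup>2) + (\<Sum>i\<in>-I - T. (x $ i)\<^sup>2)"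
      using exch by simp
    also have "\<dots> = (\<Sum>i\<in>(I - T) \<union> (-I - T). (x $ i)\<^sup>2)"
      by (rule sum.union_disjoint[symmetric]) auto
    also have "\<dots> = (\<Sum>i\<in>-T. ((x - z) $ i)\<^sup>2)"
      by (rule sum.cong) (auto simp: T_def)
    also have "\<dots> \<le> (\<Sum>i\<in>UNIV. ((x - z) $ i)\<^sup>2)"
      by (rule sum_mono2) auto
    also have "\<dots> = (norm (x - z))\<^sup>2"
      by (simp add: norm_vec_def L2_set_def sum_nonneg)
    finally show ?thesis
      by (simp add: dist_norm)
  qed
  then show ?thesis
    using assms(2) by (simp add: nearest_points_def)
qed

lemma nearest_points_sparse_empty:
  fixes x y :: "real ^ 'N"
  assumes "hard_thresholding s x y" "y \<notin> sparse_vectors s"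
  shows "nearest_points (sparse_vectors s) x = {}"
proof (rule ccontr)
  assume "nearest_points (sparse_vectors s) x \<noteq> {}"
  then obtain w where w: "w \<in> sparse_vectors s"
      "\<And>z. z \<in> sparse_vectors s \<Longrightarrow> dist x w \<le> dist x z"
    unfolding nearest_points_def by auto
  obtain I where I: "card I = s" "\<And>i j. i \<in> I \<Longrightarrow> j \<notin> I \<Longrightarrow> \<bar>x $ j\<bar> \<le> \<bar>x $ i\<bar>"
    and y: "y = (\<chi> i. if i \<in> I then x $ i else 0)"
    using assms(1) unfolding hard_thresholding_def by auto
  have "{i. y $ i \<noteq> 0} \<subseteq> I"
    by (auto simp: y)
  moreover have "{i. y $ i \<noteq> 0} \<noteq> I"
    using assms(2) I(1) by (auto simp: sparse_vectors_def norm0_def)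
  ultimately obtain i0 where i0: "i0 \<in> I" "x $ i0 = 0"
    by (auto simp: y split: if_splits)
  have out: "x $ j = 0" if "j \<notin> I" for j
    using I(2)[OF i0(1) that] i0(2) by simp
  have "x = y" using out by (auto simp: y vec_eq_iff)
  then have "x \<noteq> w" using assms(2) w(1) by auto
  define d where "d = dist x w / (2 * real CARD('N))"
  have d: "d > 0" using \<open>x \<noteq> w\<close> by (simp add: d_def)
  define z :: "real ^ 'N" where
    "z = (\<chi> i. if i \<in> I then (if x $ i = 0 then d else x $ i) else 0)"
  have "{i. z $ i \<noteq> 0} = I" using d by (auto simp: z_def)
  then have "z \<in> sparse_vectors s" by (simp add: sparse_vectors_def norm0_def I(1))
  then have "dist x w \<le> norm (x - z)" using w(2) by (simp add: dist_norm)
  also have "\<dots> \<le> (\<Sum>i\<in>UNIV. \<bar>(x - z) $ i\<bar>)" by (rule norm_le_l1_cart)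
  also have "\<dots> \<le> (\<Sum>i\<in>(UNIV::'N set). d)"
    using d out by (intro sum_mono) (auto simp: z_def)
  also have "\<dots> = dist x w / 2" by (simp add: d_def)
  finally show False using \<open>x \<noteq> w\<close> by simp
qed

lemma hard_thresholding_is_nearest_point_map:
  fixes P :: "real ^ 'N \<Rightarrow> real ^ 'N"
  assumes "\<And>x. hard_thresholding s x (P x)"
  shows "nearest_point_map (sparse_vectors s) P"
  unfolding nearest_point_map_def
proof (intro allI impI)
  fix x :: "real ^ 'N" assume ne: "nearest_points (sparse_vectors s) x \<noteq> {}"
  show "P x \<in> nearest_points (sparse_vectors s) x"
  proof (cases "P x \<in> sparse_vectors s")
    case True
    then show ?thesis by (rule hard_thresholding_nearest[OF assms])
  next
    case False
    then show ?thesis using nearest_points_sparse_empty[OF assms False] ne by simp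
  qed
qed

lemma closest_point_affine_solutions:
  assumes "affine_solutions A b \<noteq> {}"
  shows "closest_point (affine_solutions A b) x \<in> affine_solutions A b"
    and "z \<in> affine_solutions A b \<Longrightarrow>
      orthogonal (x - closest_point (affine_solutions A b) x)
        (z - closest_point (affine_solutions A b) x)"
proof -
  let ?S = "affine_solutions A b" and ?p = "closest_point (affine_solutions A b) x"
  have cl: "closed ?S"
    unfolding affine_solutions_def
    by (intro closed_Collect_eq continuous_on_const matrix_vector_mult_linear_continuous_on)
  have cv: "convex ?S"
    unfolding affine_solutions_def convex_def
    by (simp add: matrix_vector_right_distrib matrix_vector_mult_scaleR flip: scaleR_left_distrib)
  show p: "?p \<in> ?S" by (rule closest_point_in_set[OF cl assms])
  assume z: "z \<in> ?S"
  have "A *v (?p + (?p - z)) = A *v ?p + (A *v ?p - A *v z)"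
    by (simp only: matrix_vector_right_distrib matrix_vector_mult_diff_distrib)
  then have z': "?p + (?p - z) \<in> ?S"
    using p z unfolding affine_solutions_def mem_Collect_eq by simp
  have "inner (x - ?p) (z - ?p) \<le> 0" by (rule closest_point_dot[OF cv cl z])
  moreover have "inner (x - ?p) (?p + (?p - z) - ?p) \<le> 0" by (rule closest_point_dot[OF cv cl z'])
  ultimately show "orthogonal (x - ?p) (z - ?p)"
    by (simp add: orthogonal_def inner_diff_right inner_add_right)
qed

end

theory Submission
  imports Defs
begin

text \<open>
  Let \<open>T\<close> be the support of \<open>xstar\<close>. Near \<open>xstar\<close> the entries indexed by \<open>T\<close> dominate all others,
  so the nearest point with \<open>s\<close> nonzero entries is unique and is obtained by restricting to \<open>T\<close>;
  the iteration is therefore locally an alternating projection between the coordinate subspace of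
  \<open>T\<close> and the affine solution set. Isolation says that \<open>A\<close> is injective on this subspace, hence
  bounded below there by some \<open>\<beta> > 0\<close>. If \<open>u\<close> lies in the subspace and \<open>p\<close> is the projection of
  \<open>xstar + u\<close>, then \<open>A (xstar + u - p) = A u\<close>, so the projection removes from \<open>u\<close> an orthogonal
  component of norm at least \<open>(\<beta> / K) * norm u\<close>, where \<open>K\<close> bounds the operator norm of \<open>A\<close>;
  Pythagoras gives the contraction.
\<close>

definition restrict_coords :: "'N set \<Rightarrow> real ^ 'N \<Rightarrow> real ^ 'N" where
  "restrict_coords T x = (\<chi> i. if i \<in> T then x $ i else 0)"

text \<open>One difference vanishes on \<open>T\<close>, the other off \<open>T\<close>, so they are
  orthogonal.\<close>

lemma restrict_coords_Pythagoras:
  fixes x z :: "real ^ 'N"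
  assumes "\<And>i. i \<notin> T \<Longrightarrow> z $ i = 0"
  shows "(norm (x - z))\<^sup>2 =
    (norm (x - restrict_coords T x))\<^sup>2 + (norm (restrict_coords T x - z))\<^sup>2"
proof -
  have "orthogonal (x - restrict_coords T x) (restrict_coords T x - z)"
    unfolding orthogonal_def inner_vec_def
    by (rule sum.neutral) (auto simp: restrict_coords_def assms)
  from norm_add_Pythagorean[OF this] show ?thesis by simp
qed

lemma support_gap:
  fixes x :: "real ^ 'N"
  obtains r where "0 < r" "\<And>i. x $ i \<noteq> 0 \<Longrightarrow> 2 * r \<le> \<bar>x $ i\<bar>"
proof
  \<comment> \<open>Inserting 1 keeps the set nonempty when \<open>x\<close> is zero.\<close>
  let ?M = "insert 1 ((\<lambda>i. \<bar>x $ i\<bar>) ` {i. x $ i \<noteq> 0})"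
  show "0 < Min ?M / 2" by (subst zero_less_divide_iff) (simp add: Min_gr_iff)
  show "2 * (Min ?M / 2) \<le> \<bar>x $ i\<bar>" if "x $ i \<noteq> 0" for i
    using that by (simp add: Min_le)
qed

text \<open>A competitor with the same support loses by Pythagoras. One with another support of
  equal size vanishes at some index of the support of \<open>xstar\<close>, which alone costs more
  than \<open>r\<close>, while the restriction lies within \<open>r\<close> of
  \<open>x\<close>.\<close>

lemma nearest_points_sparse_vectors_near:
  fixes x xstar :: "real ^ 'N"
  assumes star: "xstar \<in> sparse_vectors s"
    and gap: "\<And>i. xstar $ i \<noteq> 0 \<Longrightarrow> 2 * r \<le> \<bar>xstar $ i\<bar>"
    and near: "norm (x - xstar) < r"
  shows "nearest_points (sparse_vectors s) x = {restrict_coords {i. xstar $ i \<noteq> 0} x}"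
proof -
  let ?T = "{i. xstar $ i \<noteq> 0}"
  let ?y = "restrict_coords {i. xstar $ i \<noteq> 0} x"
  have big: "r < \<bar>x $ i\<bar>" if "xstar $ i \<noteq> 0" for i
    using gap[OF that] component_le_norm_cart[of "x - xstar" i] near by simp
  have r: "0 < r" using near norm_ge_zero[of "x - xstar"] by linarith
  have "{i. ?y $ i \<noteq> 0} = ?T"
    using big r by (fastforce simp: restrict_coords_def)
  then have y: "?y \<in> sparse_vectors s"
    using star by (simp add: sparse_vectors_def norm0_def)
  have "(norm (x - ?y))\<^sup>2 \<le> (norm (x - xstar))\<^sup>2"
    by (subst restrict_coords_Pythagoras[of ?T xstar x]) auto
  then have small: "norm (x - ?y) < r"
    using near by (simp add: power2_le_iff_abs_le)
  have closer: "norm (x - ?y) < norm (x - z)" if z: "z \<in> sparse_vectors s" "z \<noteq> ?y" for z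
  proof (cases "{i. z $ i \<noteq> 0} = ?T")
    case True
    then have "(norm (x - z))\<^sup>2 = (norm (x - ?y))\<^sup>2 + (norm (?y - z))\<^sup>2"
      by (intro restrict_coords_Pythagoras) auto
    moreover have "0 < (norm (?y - z))\<^sup>2" using z by simp
    ultimately have "(norm (x - ?y))\<^sup>2 < (norm (x - z))\<^sup>2" by linarith
    then show ?thesis by (rule power2_less_imp_less) simp
  next
    case False
    have "card {i. z $ i \<noteq> 0} = card ?T"
      using z star by (simp add: sparse_vectors_def norm0_def)
    with False have "\<not> ?T \<subseteq> {i. z $ i \<noteq> 0}"
      using card_subset_eq[of "{i. z $ i \<noteq> 0}" ?T] by auto
    then obtain i where i: "xstar $ i \<noteq> 0" "z $ i = 0" by auto
    have "\<bar>x $ i\<bar> \<le> norm (x - z)" using component_le_norm_cart[of "x - z" i] i by simp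
    then show ?thesis using big[OF i(1)] small by simp
  qed
  show ?thesis
    unfolding nearest_points_def dist_norm
    using y closer by (force intro: less_imp_le dest: leD)
qed

text \<open>Moving from \<open>xstar\<close> by a small multiple of \<open>v\<close> changes neither
  the support nor the value of \<open>A\<close>, so isolation forces that multiple to be
  zero.\<close>

lemma isolated_kernel_trivial:
  fixes A :: "real ^ 'N ^ 'n" and xstar v :: "real ^ 'N"
  assumes iso: "xstar isolated_in (sparse_vectors s \<inter> affine_solutions A b)"
    and supp: "\<And>i. xstar $ i = 0 \<Longrightarrow> v $ i = 0"
    and ker: "A *v v = 0"
  shows "v = 0"
proof -
  obtain r where r: "0 < r" "\<And>i. xstar $ i \<noteq> 0 \<Longrightarrow> 2 * r \<le> \<bar>xstar $ i\<bar>"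
    using support_gap by blast
  obtain U where U: "open U" "U \<inter> (sparse_vectors s \<inter> affine_solutions A b) = {xstar}"
    using iso by (auto simp: isolated_in_def)
  then obtain e where e: "0 < e" "ball xstar e \<subseteq> U"
    using openE by blast
  \<comment> \<open>A step shorter than \<open>e\<close> stays in \<open>U\<close>, and one shorter
    than \<open>r\<close> kills no entry of the support. The summand 1 allows for
    \<open>v = 0\<close>.\<close>
  define t where "t = min e r / (norm v + 1)"
  have t: "0 < t" using e r by (simp add: t_def add_nonneg_pos)
  have "t * norm v < t * (norm v + 1)" using t by simp
  also have "\<dots> = min e r"
    using norm_ge_zero[of v] by (simp add: t_def add_nonneg_eq_0_iff)
  finally have tv: "norm (t *\<^sub>R v) < min e r" using t by simp
  have "xstar $ i + t * v $ i \<noteq> 0" if "xstar $ i \<noteq> 0" for i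
    using r(1) r(2)[OF that] component_le_norm_cart[of "t *\<^sub>R v" i] tv by auto
  then have "{i. (xstar + t *\<^sub>R v) $ i \<noteq> 0} = {i. xstar $ i \<noteq> 0}"
    using supp by auto
  then have "xstar + t *\<^sub>R v \<in> sparse_vectors s \<inter> affine_solutions A b"
    using U(2) ker
    by (auto simp: sparse_vectors_def norm0_def affine_solutions_def matrix_vector_right_distrib
        matrix_vector_mult_scaleR)
  moreover have "xstar + t *\<^sub>R v \<in> U"
    using e(2) tv by (auto simp: dist_norm)
  ultimately have "xstar + t *\<^sub>R v = xstar" using U(2) by blast
  then show ?thesis using t by simp
qed

lemma closest_point_affine_contraction:
  fixes A :: "real ^ 'N ^ 'n" and xstar :: "real ^ 'N"
  assumes star: "xstar \<in> affine_solutions A b"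
    and W: "subspace W"
    and ker: "\<And>v. v \<in> W \<Longrightarrow> A *v v = 0 \<Longrightarrow> v = 0"
  obtains c where "0 < c" "c < 1"
    "\<And>u. u \<in> W \<Longrightarrow>
      norm (closest_point (affine_solutions A b) (xstar + u) - xstar) \<le> c * norm u"
proof -
  have lin: "bounded_linear ((*v) A)" by (rule matrix_vector_mul_bounded_linear)
  obtain \<beta> where \<beta>: "0 < \<beta>" "\<And>v. v \<in> W \<Longrightarrow> \<beta> * norm v \<le> norm (A *v v)"
    using injective_imp_isometric[OF closed_subspace[OF W] W lin] ker by (auto simp: mult.commute)
  obtain K where K: "0 < K" "\<And>v. norm (A *v v) \<le> norm v * K"
    using bounded_linear.pos_bounded[OF lin] by blast
  \<comment> \<open>The cap 1/2 keeps \<open>1 - \<delta>\<^sup>2\<close> positive, since nothing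
    here forces \<open>\<beta> / K\<close> below 1.\<close>
  define \<delta> where "\<delta> = min (\<beta> / K) (1 / 2)"
  define c where "c = sqrt (1 - \<delta>\<^sup>2)"
  have \<delta>: "0 < \<delta>" "\<delta> \<le> 1 / 2" "\<delta> \<le> \<beta> / K"
    using \<beta> K unfolding \<delta>_def by (simp, simp_all only: min.cobounded1 min.cobounded2)
  then have \<delta>2: "0 < \<delta>\<^sup>2" "\<delta>\<^sup>2 < 1" by (auto simp: power_less_one_iff)
  show ?thesis
  proof
    show "0 < c" "c < 1" using \<delta>2 by (auto simp: c_def)
    fix u assume u: "u \<in> W"
    let ?p = "closest_point (affine_solutions A b) (xstar + u)"
    have p: "?p \<in> affine_solutions A b" and
      orth: "orthogonal (xstar + u - ?p) (xstar - ?p)"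
      using closest_point_affine_solutions[of A b] star by blast+
    have "A *v (xstar + u - ?p) = A *v u"
      using p star by (simp add: affine_solutions_def matrix_vector_right_distrib
          matrix_vector_mult_diff_distrib)
    then have "\<beta> * norm u \<le> norm (xstar + u - ?p) * K"
      using \<beta>(2)[OF u] K(2)[of "xstar + u - ?p"] by simp
    then have "\<beta> / K * norm u \<le> norm (xstar + u - ?p)"
      using K(1) by (simp add: field_simps)
    moreover have "\<delta> * norm u \<le> \<beta> / K * norm u" using \<delta>(3) by (rule mult_right_mono) simp
    ultimately have "(\<delta> * norm u)\<^sup>2 \<le> (norm (xstar + u - ?p))\<^sup>2"
      using \<delta>(1) by (intro power_mono) auto
    \<comment> \<open>As \<open>xstar\<close> is itself a solution, \<open>?p - xstar\<close> is
      orthogonal to the residual \<open>xstar + u - ?p\<close>, and the two add up to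
      \<open>u\<close>.\<close>
    moreover have "(norm u)\<^sup>2 = (norm (xstar + u - ?p))\<^sup>2 + (norm (?p - xstar))\<^sup>2"
      using norm_add_Pythagorean[of "xstar + u - ?p" "?p - xstar"] orth
      by (simp add: orthogonal_def inner_diff_right)
    ultimately have "(norm (?p - xstar))\<^sup>2 \<le> (1 - \<delta>\<^sup>2) * (norm u)\<^sup>2"
      by (simp add: power_mult_distrib algebra_simps)
    also have "\<dots> = (c * norm u)\<^sup>2" using \<delta>2 by (simp add: c_def power_mult_distrib)
    finally show "norm (?p - xstar) \<le> c * norm u"
      by (rule power2_le_imp_le) (use \<open>0 < c\<close> in auto)
  qed
qed

theorem theorem6:
  fixes A :: "real ^ 'N ^ 'n" and b :: "real ^ 'n" and s :: nat
    and P :: "real ^ 'N \<Rightarrow> real ^ 'N" and xstar :: "real ^ 'N"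
  assumes "nearest_point_map (sparse_vectors s) P"
    and "xstar isolated_in (sparse_vectors s \<inter> affine_solutions A b)"
  shows "\<exists>V c. open V \<and> xstar \<in> V \<and> 0 < c \<and> c < 1 \<and>
    (\<forall>x y. x 0 \<in> V \<and> x 0 \<in> affine_solutions A b \<and>
        alternating_projections P (closest_point (affine_solutions A b)) x y \<longrightarrow>
      (\<forall>k. norm (x k - xstar) \<le> c ^ k * norm (x 0 - xstar)))"
proof -
  let ?T = "{i. xstar $ i \<noteq> 0}"
  let ?Q = "closest_point (affine_solutions A b)"
  define W where "W = {v :: real ^ 'N. \<forall>i. xstar $ i = 0 \<longrightarrow> v $ i = 0}"
  have star: "xstar \<in> sparse_vectors s" "xstar \<in> affine_solutions A b"
    using assms(2) by (auto simp: isolated_in_def)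
  obtain r where r: "0 < r" "\<And>i. xstar $ i \<noteq> 0 \<Longrightarrow> 2 * r \<le> \<bar>xstar $ i\<bar>"
    using support_gap by blast
  have "subspace W" by (auto simp: W_def subspace_def)
  moreover have "v = 0" if "v \<in> W" "A *v v = 0" for v
    using isolated_kernel_trivial[OF assms(2)] that by (simp add: W_def)
  ultimately obtain c where c: "0 < c" "c < 1"
    "\<And>u. u \<in> W \<Longrightarrow> norm (?Q (xstar + u) - xstar) \<le> c * norm u"
    using closest_point_affine_contraction[OF star(2)] by blast
  have step: "norm (?Q (P x) - xstar) \<le> c * norm (x - xstar)" if near: "norm (x - xstar) < r" for x
  proof -
    \<comment> \<open>The set of nearest points is a singleton here, so every selection
      \<open>P\<close> takes the same value.\<close>
    have "P x = restrict_coords ?T x"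
      using assms(1) nearest_points_sparse_vectors_near[OF star(1) r(2) near]
      unfolding nearest_point_map_def by fastforce
    moreover have "(norm (restrict_coords ?T x - xstar))\<^sup>2 \<le> (norm (x - xstar))\<^sup>2"
      by (subst restrict_coords_Pythagoras[of ?T xstar x]) auto
    ultimately have "norm (P x - xstar) \<le> norm (x - xstar)" "P x - xstar \<in> W"
      by (auto simp: power2_le_iff_abs_le W_def restrict_coords_def)
    then show ?thesis
      using c(3)[of "P x - xstar"] c(1) by (auto intro: order_trans mult_left_mono)
  qed
  have "norm (x k - xstar) \<le> c ^ k * norm (x 0 - xstar)"
    if x0: "x 0 \<in> ball xstar r" and alt: "alternating_projections P ?Q x y" for x y k
  proof (induction k)
    case (Suc k)
    \<comment> \<open>Because \<open>c ^ k \<le> 1\<close>, the induction hypothesis also keeps the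
      iterate in the ball where \<open>step\<close> applies.\<close>
    have "c ^ k * norm (x 0 - xstar) \<le> 1 * norm (x 0 - xstar)"
      using c by (intro mult_right_mono power_le_one) auto
    then have "norm (x k - xstar) < r"
      using Suc x0 by (simp add: dist_norm norm_minus_commute)
    then have "norm (x (Suc k) - xstar) \<le> c * norm (x k - xstar)"
      using step alt by (simp add: alternating_projections_def)
    also have "\<dots> \<le> c * (c ^ k * norm (x 0 - xstar))"
      using Suc c(1) by (intro mult_left_mono) auto
    finally show ?case by simp
  qed simp
  then show ?thesis
    using r(1) c by (intro exI[of _ "ball xstar r"] exI[of _ c]) auto
qed

end
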